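(* Let $\mathbb K$ be an algebraically closed field of characteristic zero and $R=\mathbb K[x_1,\ldots,x_n]$. Let $f\in R$ be a weighted homogeneous polynomial of (standard) degree $d$ and rational weights $a_1,\ldots,a_n$. Let $F\in R[t]$ be the homogenization of $f$ with respect to a new variable $t$. Then the partial derivatives of $F$ admit the following linear syzygy: $$(da_1-1)x_1F_{x_1}+\cdots+(da_n-1)x_nF_{x_n}-tF_t=0.$$
   Context: A polynomial $f\in\mathbb K[x_1,\ldots,x_n]$ is weighted homogeneous with rational weights $a_1,\dots,a_n$ ($0<a_i\le\frac12$) if $f(s^{a_1}x_1,\ldots,s^{a_n}x_n)=s\,f(x_1,\ldots,x_n)$, where $s$ is an indeterminate; equivalently $f=\sum_i a_ix_if_{x_i}$. The homogenization of $f$ of degree $d$ is $F=t^df(x_1/t,\ldots,x_n/t)$. Subscripts denote partial derivatives. *)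

theory Defs
  imports
    "HOL-Library.Poly_Mapping"
    "HOL-Computational_Algebra.Computational_Algebra"
begin

text \<open>
  Polynomials over \<open>'k\<close> in finitely many variables indexed by the type \<open>'v\<close>: finitely supported
  maps from exponent vectors to coefficients, with the convolution product of
  \<open>HOL-Library.Poly_Mapping\<close>.
\<close>

type_synonym ('v, 'k) mpoly = "('v \<Rightarrow>\<^sub>0 nat) \<Rightarrow>\<^sub>0 'k"

definition Const :: "'k \<Rightarrow> ('v, 'k::zero) mpoly" where
  "Const c = Poly_Mapping.single 0 c"

definition Var :: "'v \<Rightarrow> ('v, 'k::zero_neq_one) mpoly" where
  "Var v = Poly_Mapping.single (Poly_Mapping.single v 1) 1"

definition mdegree :: "('v::finite \<Rightarrow>\<^sub>0 nat) \<Rightarrow> nat" where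
  "mdegree m = (\<Sum>v\<in>UNIV. Poly_Mapping.lookup m v)"

text \<open>The standard degree; by convention it is \<open>0\<close> for the zero polynomial.\<close>

definition total_degree :: "('v::finite, 'k::zero) mpoly \<Rightarrow> nat" where
  "total_degree f = Max (insert 0 (mdegree ` Poly_Mapping.keys f))"

text \<open>
  When \<open>v\<close> does not occur in the monomial \<open>m\<close>, the truncated exponent is harmless, because the
  coefficient vanishes.
\<close>

definition partial :: "'v \<Rightarrow> ('v, 'k::comm_semiring_1) mpoly \<Rightarrow> ('v, 'k) mpoly" where
  "partial v f = (\<Sum>m\<in>Poly_Mapping.keys f.
     Poly_Mapping.single (m - Poly_Mapping.single v 1)
       (of_nat (Poly_Mapping.lookup m v) * Poly_Mapping.lookup f m))"

text \<open>
  Substitution of elements \<open>x v\<close> of a commutative ring for the variables, where \<open>h\<close> embeds the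
  coefficients in that ring.
\<close>

definition msubst ::
  "('k \<Rightarrow> 'r) \<Rightarrow> ('v \<Rightarrow> 'r) \<Rightarrow> ('v::finite, 'k::zero) mpoly \<Rightarrow> 'r::comm_semiring_1" where
  "msubst h x f = (\<Sum>m\<in>Poly_Mapping.keys f.
     h (Poly_Mapping.lookup f m) * (\<Prod>v\<in>UNIV. x v ^ Poly_Mapping.lookup m v))"

text \<open>
  The identity \<open>f(s^(a 1) x_1, \<dots>, s^(a n) x_n) = s f(x_1, \<dots>, x_n)\<close> with an indeterminate \<open>s\<close> lives in
  the ring of polynomials in rational powers of \<open>s\<close> over \<open>R = 'k[x_1, \<dots>, x_n]\<close>, that is, in
  the type \<open>rat \<Rightarrow>\<^sub>0 R\<close>, in which \<open>single q r\<close> is \<open>r s^q\<close>.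
\<close>

definition weighted_homogeneous ::
  "('v::finite \<Rightarrow> rat) \<Rightarrow> ('v, 'k::comm_ring_1) mpoly \<Rightarrow> bool" where
  "weighted_homogeneous a f \<longleftrightarrow>
     (\<forall>v. 0 < a v \<and> a v \<le> 1 / 2) \<and>
     msubst (\<lambda>c. Poly_Mapping.single 0 (Const c)) (\<lambda>v. Poly_Mapping.single (a v) (Var v)) f
       = (Poly_Mapping.single 1 f :: rat \<Rightarrow>\<^sub>0 ('v, 'k) mpoly)"

text \<open>
  Homogenization of degree \<open>d\<close>. The variables of the result are indexed by \<open>'v option\<close>: \<open>Some v\<close>
  stands for the old variable \<open>v\<close>, and \<open>None\<close> for the new variable \<open>t\<close>. The exponent vector \<open>m\<close> is
  extended by the exponent \<open>d - mdegree m\<close> of \<open>t\<close>; this agrees with \<open>t^d f(x_1/t, \<dots>, x_n/t)\<close>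
  whenever \<open>d\<close> is at least the degree of \<open>f\<close>, as shown below.
\<close>

definition homog_exponent :: "nat \<Rightarrow> ('v::finite \<Rightarrow>\<^sub>0 nat) \<Rightarrow> ('v option \<Rightarrow>\<^sub>0 nat)" where
  "homog_exponent d m = Abs_poly_mapping (case_option (d - mdegree m) (Poly_Mapping.lookup m))"

definition homogenization ::
  "nat \<Rightarrow> ('v::finite, 'k::comm_semiring_1) mpoly \<Rightarrow> ('v option, 'k) mpoly" where
  "homogenization d f = (\<Sum>m\<in>Poly_Mapping.keys f.
     Poly_Mapping.single (homog_exponent d m) (Poly_Mapping.lookup f m))"

lemma lookup_homog_exponent [simp]:
  "Poly_Mapping.lookup (homog_exponent d m) w =
     (case w of None \<Rightarrow> d - mdegree m | Some v \<Rightarrow> Poly_Mapping.lookup m v)"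
  by (simp add: homog_exponent_def)

lemma msubst_superset:
  assumes "finite A" "Poly_Mapping.keys f \<subseteq> A" "h 0 = 0"
  shows "msubst h x f = (\<Sum>m\<in>A.
     h (Poly_Mapping.lookup f m) * (\<Prod>v\<in>UNIV. x v ^ Poly_Mapping.lookup m v))"
  unfolding msubst_def
  by (rule sum.mono_neutral_left) (use assms in \<open>auto simp: in_keys_iff\<close>)

lemma msubst_zero [simp]: "msubst h x 0 = 0"
  by (simp add: msubst_def)

lemma msubst_single:
  "h 0 = 0 \<Longrightarrow> msubst h x (Poly_Mapping.single m c) =
     h c * (\<Prod>v\<in>UNIV. x v ^ Poly_Mapping.lookup m v)"
  by (subst msubst_superset[of "{m}"]) auto

lemma msubst_add:
  assumes "h 0 = 0" "\<And>b c. h (b + c) = h b + h c"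
  shows "msubst h x (f + g) = msubst h x f + msubst h x g"
proof -
  let ?A = "Poly_Mapping.keys f \<union> Poly_Mapping.keys g"
  have "Poly_Mapping.keys (f + g) \<subseteq> ?A" by (rule keys_add)
  then show ?thesis
    using assms by (simp add: msubst_superset[of ?A] lookup_add distrib_right sum.distrib)
qed

lemma msubst_sum:
  assumes "h 0 = 0" "\<And>b c. h (b + c) = h b + h c"
  shows "msubst h x (sum g A) = (\<Sum>i\<in>A. msubst h x (g i))"
  by (induction A rule: infinite_finite_induct) (simp_all add: msubst_add assms)

lemma single_power:
  "(Poly_Mapping.single q r :: int \<Rightarrow>\<^sub>0 'r::comm_ring_1) ^ n = Poly_Mapping.single (int n * q) (r ^ n)"
  by (induction n) (simp_all add: mult_single algebra_simps)

lemma prod_single: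
  "finite A \<Longrightarrow> (\<Prod>v\<in>A. Poly_Mapping.single (q v) (r v))
    = (Poly_Mapping.single (sum q A) (prod r A) :: int \<Rightarrow>\<^sub>0 'r::comm_ring_1)"
  by (induction A rule: finite_induct) (simp_all add: mult_single)

text \<open>
  The equation \<open>F = t^d f(x_1/t, \<dots>, x_n/t)\<close>, in the ring \<open>int \<Rightarrow>\<^sub>0 R\<close> of Laurent polynomials in \<open>t\<close>
  over \<open>R\<close>, in which \<open>single k r\<close> is \<open>r t^k\<close>.
\<close>

lemma homogenization_eq:
  fixes f :: "('v::finite, 'k::comm_ring_1) mpoly"
  assumes "total_degree f \<le> d"
  shows "msubst (\<lambda>c. Poly_Mapping.single 0 (Const c))
           (case_option (Poly_Mapping.single 1 1) (\<lambda>v. Poly_Mapping.single 0 (Var v)))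
           (homogenization d f)
       = (Poly_Mapping.single (int d) 1 :: int \<Rightarrow>\<^sub>0 ('v, 'k) mpoly) *
         msubst (\<lambda>c. Poly_Mapping.single 0 (Const c)) (\<lambda>v. Poly_Mapping.single (- 1) (Var v)) f"
proof -
  let ?h = "\<lambda>c. Poly_Mapping.single 0 (Const c) :: int \<Rightarrow>\<^sub>0 ('v, 'k) mpoly"
  let ?x = "case_option (Poly_Mapping.single 1 1) (\<lambda>v. Poly_Mapping.single 0 (Var v))
              :: 'v option \<Rightarrow> int \<Rightarrow>\<^sub>0 ('v, 'k) mpoly"
  have h: "?h 0 = 0" "\<And>b c. ?h (b + c) = ?h b + ?h c"
    by (simp_all add: Const_def single_add)
  have deg: "mdegree m \<le> d" if "m \<in> Poly_Mapping.keys f" for m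
    using that assms by (auto simp: total_degree_def)
  have split: "prod g UNIV = g None * (\<Prod>v\<in>UNIV. g (Some v))"
    for g :: "'v option \<Rightarrow> int \<Rightarrow>\<^sub>0 ('v, 'k) mpoly"
    by (simp add: UNIV_option_conv prod.reindex)
  have "msubst ?h ?x (homogenization d f)
      = (\<Sum>m\<in>Poly_Mapping.keys f. ?h (Poly_Mapping.lookup f m) *
          (\<Prod>w\<in>UNIV. ?x w ^ Poly_Mapping.lookup (homog_exponent d m) w))"
    unfolding homogenization_def msubst_sum[where h = ?h, OF h] msubst_single[where h = ?h, OF h(1)] ..
  also have "\<dots> = (\<Sum>m\<in>Poly_Mapping.keys f. Poly_Mapping.single (int d) 1 *
        (?h (Poly_Mapping.lookup f m) *
          (\<Prod>v\<in>UNIV. Poly_Mapping.single (- 1) (Var v) ^ Poly_Mapping.lookup m v)))"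
    by (rule sum.cong)
      (use deg in \<open>simp_all add: split single_power prod_single mult_single mdegree_def
                    sum_negf of_nat_diff\<close>)
  finally show ?thesis
    by (simp add: msubst_def sum_distrib_left)
qed

end

theory Submission
  imports Defs
begin

text \<open>
  The operator \<open>x\<^sub>v \<partial>/\<partial>x\<^sub>v\<close> is diagonal in the basis of monomials: it multiplies \<open>x\<^sup>m\<close> by its exponent
  \<open>m\<^sub>v\<close> (\<open>lookup_Var_times_partial\<close>). Hence so is the left-hand side of the syzygy, regarded as an
  operator applied to \<open>F\<close>, and it suffices that its eigenvalue vanishes on every monomial of \<open>F\<close>.
  Such a monomial is \<open>t\<^bsup>d-|m|\<^esup> x\<^sup>m\<close> for a monomial \<open>x\<^sup>m\<close> of \<open>f\<close>, and its eigenvalue is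
  \<open>(\<Sum>v. (d a\<^sub>v - 1) m\<^sub>v) - (d - |m|) = d ((\<Sum>v. a\<^sub>v m\<^sub>v) - 1)\<close>. Weighted homogeneity of \<open>f\<close>, read one
  monomial at a time, says precisely that \<open>\<Sum>v. a\<^sub>v m\<^sub>v = 1\<close> (\<open>weighted_homogeneous_imp_weight\<close>).
\<close>

lemma prod_single_comm_monoid:
  fixes q :: "'i \<Rightarrow> 'q::comm_monoid_add" and r :: "'i \<Rightarrow> 'r::comm_semiring_1"
  assumes "finite A"
  shows "(\<Prod>v\<in>A. Poly_Mapping.single (q v) (r v)) = Poly_Mapping.single (sum q A) (prod r A)"
  using assms by (induction A rule: finite_induct) (simp_all add: mult_single)

lemma single_power_semiring:
  fixes q :: "'q::comm_semiring_1" and r :: "'r::comm_semiring_1"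
  shows "Poly_Mapping.single q r ^ n = Poly_Mapping.single (of_nat n * q) (r ^ n)"
  by (induction n) (simp_all add: mult_single algebra_simps)

lemma Var_power:
  "(Var v :: ('v, 'k::comm_semiring_1) mpoly) ^ n = Poly_Mapping.single (Poly_Mapping.single v n) 1"
  by (induction n) (simp_all add: Var_def mult_single flip: single_add)

lemma sum_single_lookup:
  fixes m :: "'v::finite \<Rightarrow>\<^sub>0 'a::comm_monoid_add"
  shows "(\<Sum>v\<in>UNIV. Poly_Mapping.single v (Poly_Mapping.lookup m v)) = m"
  by (rule poly_mapping_eqI) (simp add: lookup_sum lookup_single when_def)

lemma prod_Var_power:
  fixes m :: "'v::finite \<Rightarrow>\<^sub>0 nat"
  shows "(\<Prod>v\<in>UNIV. (Var v :: ('v, 'k::comm_semiring_1) mpoly) ^ Poly_Mapping.lookup m v)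
    = Poly_Mapping.single m 1"
  by (simp add: Var_power prod_single_comm_monoid sum_single_lookup)

lemma lookup_Const_times:
  "Poly_Mapping.lookup (Const c * p) m = c * Poly_Mapping.lookup (p :: ('v, 'k::comm_semiring_1) mpoly) m"
proof -
  have "Const c * p = Poly_Mapping.map ((*) c) p"
    unfolding Const_def by (rule mult_map_scale_conv_mult [symmetric])
  then show ?thesis
    by (simp add: Poly_Mapping.map.rep_eq when_def)
qed

text \<open>
  Multiplying by \<open>x\<^sub>v\<close> restores the exponent lowered by differentiation. Monomials without \<open>x\<^sub>v\<close>,
  where the truncated exponent is not restored, carry the factor \<open>m\<^sub>v = 0\<close> on both sides.
\<close>

lemma lookup_Var_times_partial:
  fixes p :: "('v, 'k::comm_semiring_1) mpoly"
  shows "Poly_Mapping.lookup (Var v * partial v p) m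
    = of_nat (Poly_Mapping.lookup m v) * Poly_Mapping.lookup p m"
proof -
  have restore: "Poly_Mapping.single v 1 + (k - Poly_Mapping.single v 1) = k"
    if "Poly_Mapping.lookup k v \<noteq> 0" for k :: "'v \<Rightarrow>\<^sub>0 nat"
    using that
    by (intro poly_mapping_eqI) (auto simp: lookup_add lookup_minus lookup_single when_def)
  have "Var v * partial v p = (\<Sum>k\<in>Poly_Mapping.keys p.
      Poly_Mapping.single k (of_nat (Poly_Mapping.lookup k v) * Poly_Mapping.lookup p k))"
    unfolding partial_def Var_def sum_distrib_left mult_single
  proof (rule sum.cong)
    fix k
    show "Poly_Mapping.single (Poly_Mapping.single v 1 + (k - Poly_Mapping.single v 1))
        (1 * (of_nat (Poly_Mapping.lookup k v) * Poly_Mapping.lookup p k))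
      = Poly_Mapping.single k (of_nat (Poly_Mapping.lookup k v) * Poly_Mapping.lookup p k)"
      by (cases "Poly_Mapping.lookup k v = 0") (simp, simp only: restore mult_1_left not_False_eq_True)
  qed simp
  then show ?thesis
    by (simp add: lookup_sum lookup_single when_def in_keys_iff)
qed

text \<open>
  Substituting \<open>s\<^bsup>a v\<^esup> x\<^sub>v\<close> for \<open>x\<^sub>v\<close> multiplies the monomial \<open>x\<^sup>m\<close> by \<open>s\<^sup>w\<close> with
  \<open>w = \<Sum>v. a\<^sub>v m\<^sub>v\<close>. Different monomials of \<open>f\<close> cannot cancel, so the coefficient of \<open>s x\<^sup>m\<close> in
  \<open>f(s\<^bsup>a\<^esup> x) = s f(x)\<close> is nonzero on the left only if \<open>w = 1\<close>.
\<close>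

lemma weighted_homogeneous_imp_weight:
  fixes f :: "('v::finite, 'k::comm_ring_1) mpoly"
  assumes "weighted_homogeneous a f" and m: "m \<in> Poly_Mapping.keys f"
  shows "(\<Sum>v\<in>UNIV. of_nat (Poly_Mapping.lookup m v) * a v) = 1"
proof -
  let ?w = "\<lambda>m. \<Sum>v\<in>UNIV. of_nat (Poly_Mapping.lookup m v) * a v"
  have "(Poly_Mapping.single 1 f :: rat \<Rightarrow>\<^sub>0 ('v, 'k) mpoly)
      = msubst (\<lambda>c. Poly_Mapping.single 0 (Const c)) (\<lambda>v. Poly_Mapping.single (a v) (Var v)) f"
    using assms by (simp add: weighted_homogeneous_def)
  also have "\<dots> = (\<Sum>k\<in>Poly_Mapping.keys f.
      Poly_Mapping.single (?w k) (Poly_Mapping.single k (Poly_Mapping.lookup f k)))"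
    by (simp add: msubst_def single_power_semiring prod_single_comm_monoid prod_Var_power mult_single Const_def)
  finally have "Poly_Mapping.lookup f m = Poly_Mapping.lookup (Poly_Mapping.lookup
      (\<Sum>k\<in>Poly_Mapping.keys f.
        Poly_Mapping.single (?w k) (Poly_Mapping.single k (Poly_Mapping.lookup f k))) 1) m"
    by (metis lookup_single_eq)
  also have "\<dots> = (\<Sum>k\<in>Poly_Mapping.keys f.
      if k = m then (if ?w k = 1 then Poly_Mapping.lookup f k else 0) else 0)"
    unfolding lookup_sum by (rule sum.cong) (auto simp: lookup_single when_def)
  also have "\<dots> = (if ?w m = 1 then Poly_Mapping.lookup f m else 0)"
    using m by simp
  finally show ?thesis
    using m by (auto simp: in_keys_iff split: if_splits)
qed

lemma keys_homogenization:
  "Poly_Mapping.keys (homogenization d f) \<subseteq> homog_exponent d ` Poly_Mapping.keys f"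
  unfolding homogenization_def
  by (rule order_trans [OF keys_sum]) (auto split: if_splits)

theorem lemma2p4:
  fixes f :: "('n::finite, 'k::{alg_closed_field, field_char_0}) mpoly"
    and F :: "('n option, 'k) mpoly"
    and a :: "'n \<Rightarrow> rat"
    and d :: nat
  assumes "weighted_homogeneous a f"
    and "total_degree f = d"
    and "F = homogenization d f"
  shows "(\<Sum>i\<in>UNIV. Const (of_rat (of_nat d * a i - 1)) * Var (Some i) * partial (Some i) F)
           - Var None * partial None F = 0"
proof (rule poly_mapping_eqI)
  fix M
  \<comment> \<open>The eigenvalue, computed in the rationals and then mapped to the field.\<close>
  let ?e = "(\<Sum>i\<in>UNIV. (of_nat d * a i - 1) * of_nat (Poly_Mapping.lookup M (Some i)))
              - of_nat (Poly_Mapping.lookup M None) :: rat"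
  have "Poly_Mapping.lookup
      ((\<Sum>i\<in>UNIV. Const (of_rat (of_nat d * a i - 1)) * Var (Some i) * partial (Some i) F)
        - Var None * partial None F) M = of_rat ?e * Poly_Mapping.lookup F M"
    by (simp add: lookup_minus lookup_sum lookup_Const_times lookup_Var_times_partial mult.assoc
        of_rat_diff of_rat_sum of_rat_mult sum_distrib_right left_diff_distrib)
  also have "\<dots> = 0"
  proof (cases "M \<in> Poly_Mapping.keys F")
    case True
    then obtain m where m: "m \<in> Poly_Mapping.keys f" and M: "M = homog_exponent d m"
      using keys_homogenization assms(3) by blast
    have "mdegree m \<le> d"
      using m assms(2) by (auto simp: total_degree_def)
    then have "?e = of_nat d * ((\<Sum>i\<in>UNIV. of_nat (Poly_Mapping.lookup m i) * a i) - 1)"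
      by (simp add: M mdegree_def of_nat_diff algebra_simps sum_subtractf sum_distrib_left)
    then show ?thesis
      by (simp add: weighted_homogeneous_imp_weight [OF assms(1) m])
  qed (simp add: in_keys_iff)
  finally show "Poly_Mapping.lookup
      ((\<Sum>i\<in>UNIV. Const (of_rat (of_nat d * a i - 1)) * Var (Some i) * partial (Some i) F)
        - Var None * partial None F) M = Poly_Mapping.lookup 0 M"
    by simp
qed

end
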